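(* For every $\xi\in L^p(\mathcal F_1)$, $p\ge 2$, let $(Y,Z)$ denote the unique (square-integrable) solution of the one-dimensional BSDE $$Y_t=\xi-\int_t^1 Y_s^3\,ds-\int_t^1 Z_s\,dW_s,\qquad t\in[0,1].$$ For $N\in\mathbb N$ even, let $\pi^N$ be the uniform grid of $[0,1]$ with the $N+1$ points $t_i=i/N$ and define the explicit Euler approximation of $Y$ over $\pi^N$ by $Y^{(N)}_N=\xi$ and $$Y^{(N)}_i=\mathbb E\Big[Y^{(N)}_{i+1}-\tfrac1N\big(Y^{(N)}_{i+1}\big)^3\,\Big|\,\mathcal F_{t_i}\Big],\qquad i=N-1,\dots,0 .$$ Denote by $Y^{(N)}_{1/2}:=Y^{(N)}_{i}$ with $i=N/2$ the approximation at the time point $t=1/2$ (which belongs to all the grids $\pi^N$, $N$ even). Then there exists a random variable $\xi$ which belongs to $L^p(\mathcal F_1)\setminus L^\infty(\mathcal F_1)$ for every $p\ge2$ and is such that $$\lim_{N\to\infty,\ N\text{ even}}\mathbb E\big[\,|Y^{(N)}_{1/2}|\,\big]=+\infty .$$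
   Context: $W$ is a (one-dimensional) Brownian motion on $[0,1]$ on a complete probability space $(\Omega,\mathcal F,\mathbb P)$ and $(\mathcal F_t)_{t\in[0,1]}$ is its natural filtration augmented by the $\mathbb P$-null sets. $L^p(\mathcal F_1)$ is the space of $\mathcal F_1$-measurable random variables with finite $p$-th moment. It is known that the BSDE in the claim has a unique square-integrable solution for each such $\xi$. *)

theory Defs
  imports "HOL-Probability.Probability"
begin

text \<open>Processes on \<open>[0,1]\<close> are total functions on \<^typ>\<open>real\<close>; only times in \<open>{0..1}\<close> are ever constrained.\<close>

definition brownian_motion_01 :: "'a measure \<Rightarrow> (real \<Rightarrow> 'a \<Rightarrow> real) \<Rightarrow> bool" where
  "brownian_motion_01 M W \<longleftrightarrow>
     (\<forall>t\<in>{0..1}. W t \<in> borel_measurable M) \<and>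
     (AE \<omega> in M. W 0 \<omega> = 0) \<and>
     (\<forall>s t. 0 \<le> s \<longrightarrow> s < t \<longrightarrow> t \<le> 1 \<longrightarrow>
        distributed M lborel (\<lambda>\<omega>. W t \<omega> - W s \<omega>) (\<lambda>x. ennreal (normal_density 0 (sqrt (t - s)) x))) \<and>
     (\<forall>(n::nat) t. (\<forall>i\<le>n. t i \<in> {0..1}) \<longrightarrow> (\<forall>i<n. t i \<le> t (Suc i)) \<longrightarrow>
        prob_space.indep_vars M (\<lambda>_. borel) (\<lambda>i \<omega>. W (t (Suc i)) \<omega> - W (t i) \<omega>) {..<n}) \<and>
     (AE \<omega> in M. continuous_on {0..1} (\<lambda>t. W t \<omega>))"

text \<open>Only the space and the sets of this measure are meaningful: it serves as a sub-\<open>\<sigma>\<close>-algebra of \<open>M\<close>.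
  When \<open>M\<close> is complete, \<^term>\<open>null_sets M\<close> contains every subset of a null event.\<close>

definition augmented_filtration ::
    "'a measure \<Rightarrow> (real \<Rightarrow> 'a \<Rightarrow> real) \<Rightarrow> real \<Rightarrow> 'a measure" where
  "augmented_filtration M W t =
     sigma (space M)
       ({W s -` A \<inter> space M | s A. 0 \<le> s \<and> s \<le> t \<and> A \<in> sets borel} \<union> null_sets M)"

definition Lp_rv :: "'a measure \<Rightarrow> 'a measure \<Rightarrow> real \<Rightarrow> ('a \<Rightarrow> real) set" where
  "Lp_rv M G p = {\<xi> \<in> borel_measurable G. integrable M (\<lambda>\<omega>. \<bar>\<xi> \<omega>\<bar> powr p)}"

definition Linfty_rv :: "'a measure \<Rightarrow> 'a measure \<Rightarrow> ('a \<Rightarrow> real) set" where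
  "Linfty_rv M G = {\<xi> \<in> borel_measurable G. \<exists>C. AE \<omega> in M. \<bar>\<xi> \<omega>\<bar> \<le> C}"

text \<open>The explicit Euler scheme on the grid \<open>i / N\<close> for the BSDE with terminal value \<open>\<xi>\<close> and driver
  \<open>y \<mapsto> - y\<^sup>3\<close>. It is built from \<open>\<xi>\<close> and the filtration \<open>F\<close> alone; the exact solution \<open>(Y, Z)\<close> does not
  enter. Indices \<open>i > N\<close> are outside the scheme and get the junk value \<open>\<xi>\<close>.\<close>

function explicit_euler ::
    "'a measure \<Rightarrow> (real \<Rightarrow> 'a measure) \<Rightarrow> ('a \<Rightarrow> real) \<Rightarrow> nat \<Rightarrow> nat \<Rightarrow> 'a \<Rightarrow> real" where
  "explicit_euler M F \<xi> N i =
     (if i < N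
      then real_cond_exp M (F (real i / real N))
             (\<lambda>\<omega>. explicit_euler M F \<xi> N (Suc i) \<omega> - 1 / real N * (explicit_euler M F \<xi> N (Suc i) \<omega>) ^ 3)
      else \<xi>)"
  by pat_completeness auto
termination
  by (relation "Wellfounded.measure (\<lambda>(M, F, \<xi>, N, i). N - i)") auto

declare explicit_euler.simps [simp del]

end

theory Submission
  imports Defs "HOL-Real_Asymp.Real_Asymp"
begin

text \<open>The explicit step \<open>y \<mapsto> y - y\<^sup>3 / N\<close> is stable only while \<open>\<bar>y\<bar>\<close> is of order at most
  \<open>sqrt N\<close>. Beyond \<open>2 * sqrt N\<close> the cubic term overshoots: with \<open>v = \<bar>y\<bar> / sqrt N \<ge> 2\<close> one step turns
  \<open>v\<close> into \<open>v * (v\<^sup>2 - 1) \<ge> v\<^sup>2\<close>, so \<open>N div 2\<close> steps produce a value of at least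
  \<open>sqrt N * 2 ^ 2 ^ (N div 2)\<close>, which is doubly exponential in \<open>N\<close> (lemma \<open>euler_step_iterate_growth\<close>).
  A Gaussian terminal value exceeds \<open>2 * sqrt N\<close> with a probability that is only simply exponentially
  small (lemma \<open>normal_density_le_tail\<close>), and this cannot compensate for the growth.

  It remains to choose the terminal value so that averaging over the Brownian paths does not interfere.
  The increment \<open>\<xi> = W (1/2) - W 0\<close> is known at time \<open>1/2\<close>, so all conditional expectations at grid
  times in \<open>[1/2, 1]\<close> act trivially and the scheme at time \<open>1/2\<close> is the deterministic iteration applied
  to \<open>\<xi>\<close> (lemma \<open>explicit_euler_adapted_terminal\<close>). Every iterate is a polynomial in a Gaussian
  variable and thus integrable, so that these conditional expectations and the final expectation are
  genuine ones.\<close>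

section \<open>The deterministic Euler iteration\<close>

definition euler_step :: "nat \<Rightarrow> real \<Rightarrow> real" where
  "euler_step N y = y - 1 / real N * y ^ 3"

text \<open>Iterates are exhibited as polynomials for the sake of integrability: all moments of a Gaussian
  are finite.\<close>

lemma euler_step_iterate_poly: "\<exists>P :: real poly. \<forall>y. (euler_step N ^^ k) y = poly P y"
proof (induction k)
  case 0
  have "\<forall>y. (euler_step N ^^ 0) y = poly [:0, 1:] y" by simp
  then show ?case by blast
next
  case (Suc k)
  then obtain P :: "real poly" where P: "\<And>y. (euler_step N ^^ k) y = poly P y" by blast
  have "(euler_step N ^^ Suc k) y = poly (P - smult (1 / real N) (P ^ 3)) y" for y
    using P[of y] by (simp add: euler_step_def)
  then show ?case by blast
qed

text \<open>One step multiplies \<open>\<bar>y\<bar>\<close> by \<open>\<bar>1 - y\<^sup>2 / N\<bar> \<ge> v\<^sup>2 - 1\<close>, and \<open>v \<ge> 2\<close> gives \<open>v\<^sup>2 - 1 \<ge> v\<close>. Keeping only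
  this factor \<open>v\<close> makes the step a squaring in units of \<open>sqrt N\<close>, which is easy to iterate.\<close>

lemma euler_step_growth:
  assumes N: "N > 0" and v: "v \<ge> 2" and y: "\<bar>y\<bar> \<ge> sqrt N * v"
  shows "\<bar>euler_step N y\<bar> \<ge> sqrt N * v\<^sup>2"
proof -
  define u where "u = \<bar>y\<bar> / sqrt N"
  have sN: "sqrt N > 0" using N by simp
  have u: "u \<ge> v" "\<bar>y\<bar> = sqrt N * u"
    using y sN by (simp_all add: u_def field_simps)
  have "y\<^sup>2 = real N * u\<^sup>2"
    using u(2) by (metis of_nat_0_le_iff power2_abs power_mult_distrib real_sqrt_pow2)
  then have "euler_step N y = y * (1 - u\<^sup>2)"
    using N by (simp add: euler_step_def field_simps power3_eq_cube power2_eq_square)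
  moreover have "\<bar>1 - u\<^sup>2\<bar> \<ge> u"
  proof -
    have "2 * u \<le> u * u" using u v by (intro mult_right_mono) auto
    then have "u \<le> u\<^sup>2 - 1" using u v unfolding power2_eq_square by linarith
    then show ?thesis by linarith
  qed
  ultimately have "\<bar>euler_step N y\<bar> \<ge> (sqrt N * u) * u"
    using u v sN by (simp add: abs_mult mult_left_mono)
  moreover have "v * v \<le> u * u" using u v by (intro mult_mono) auto
  then have "sqrt N * (v * v) \<le> sqrt N * (u * u)" using sN by (intro mult_left_mono) auto
  ultimately show ?thesis by (simp add: power2_eq_square mult.assoc)
qed

lemma euler_step_iterate_growth:
  assumes N: "N > 0" and y: "\<bar>y\<bar> \<ge> 2 * sqrt N"
  shows "\<bar>(euler_step N ^^ k) y\<bar> \<ge> sqrt N * 2 ^ 2 ^ k"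
proof (induction k)
  case 0
  then show ?case using y by (simp add: mult.commute)
next
  case (Suc k)
  have "(2::real) ^ 1 \<le> 2 ^ 2 ^ k" by (intro power_increasing) auto
  then have "\<bar>euler_step N ((euler_step N ^^ k) y)\<bar> \<ge> sqrt N * (2 ^ 2 ^ k)\<^sup>2"
    using Suc by (intro euler_step_growth N) auto
  then show ?case by (simp add: power_mult[symmetric] mult.commute)
qed

section \<open>Moments and tails of a centred Gaussian variable\<close>

context prob_space
begin

lemma integrable_normal_power:
  assumes X: "distributed M lborel X (\<lambda>x. ennreal (normal_density 0 s x))" and s: "s > 0"
  shows "integrable M (\<lambda>\<omega>. X \<omega> ^ k)"
proof -
  have "integrable lborel (\<lambda>x. normal_density 0 s x * x ^ k)"
    using integrable_normal_moment[OF s, of 0 k] by simp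
  then show ?thesis
    by (subst distributed_integrable[OF X, symmetric]) auto
qed

lemma integrable_normal_poly:
  assumes X: "distributed M lborel X (\<lambda>x. ennreal (normal_density 0 s x))" and s: "s > 0"
  shows "integrable M (\<lambda>\<omega>. poly P (X \<omega>))"
  unfolding poly_altdef
  by (intro Bochner_Integration.integrable_sum integrable_mult_right integrable_normal_power[OF X s])

lemma integrable_normal_abs_powr:
  assumes X: "distributed M lborel X (\<lambda>x. ennreal (normal_density 0 s x))" and s: "s > 0"
    and p: "p \<ge> 0"
  shows "integrable M (\<lambda>\<omega>. \<bar>X \<omega>\<bar> powr p)"
proof -
  define n where "n = nat \<lceil>p\<rceil>"
  have n: "p \<le> real (2 * n)" using p unfolding n_def by linarith
  have [measurable]: "X \<in> borel_measurable M" using X by (simp add: distributed_def)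
  have bound: "\<bar>x\<bar> powr p \<le> 1 + x ^ (2 * n)" for x :: real
  proof (cases "\<bar>x\<bar> \<le> 1")
    case True
    then have "\<bar>x\<bar> powr p \<le> 1 powr p" using p by (intro powr_mono2) auto
    moreover have "x ^ (2 * n) \<ge> 0" by (simp add: power_mult)
    ultimately show ?thesis unfolding powr_one_eq_one by linarith
  next
    case False
    then have "\<bar>x\<bar> powr p \<le> \<bar>x\<bar> powr real (2 * n)" using n by (intro powr_mono) auto
    also have "\<dots> = x ^ (2 * n)" using False by (subst powr_realpow) (auto simp: power_even_abs)
    finally show ?thesis by simp
  qed
  show ?thesis
  proof (rule Bochner_Integration.integrable_bound)
    show "integrable M (\<lambda>\<omega>. 1 + X \<omega> ^ (2 * n))"
      by (intro Bochner_Integration.integrable_add integrable_const integrable_normal_power[OF X s])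
    show "AE \<omega> in M. norm (\<bar>X \<omega>\<bar> powr p) \<le> norm (1 + X \<omega> ^ (2 * n))"
      using bound by (auto intro: order_trans[OF _ abs_ge_self])
  qed measurable
qed

text \<open>The density decreases on \<open>{0..}\<close>, so the mass of the unit interval \<open>{a..a + 1}\<close> is at least the
  value at its right end.\<close>

lemma normal_density_le_tail:
  assumes X: "distributed M lborel X (\<lambda>x. ennreal (normal_density 0 s x))" and a: "a \<ge> 0"
  shows "normal_density 0 s (a + 1) \<le> prob {\<omega> \<in> space M. a \<le> X \<omega>}"
proof -
  let ?d = "normal_density 0 s"
  have [measurable]: "X \<in> borel_measurable M" using X by (simp add: distributed_def)
  have mono: "?d (a + 1) \<le> ?d x" if "x \<in> {a..a + 1}" for x
  proof -
    have "x\<^sup>2 \<le> (a + 1)\<^sup>2" using that a by (intro power_mono) auto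
    then show ?thesis
      unfolding normal_density_def by (intro mult_left_mono) (auto simp: divide_right_mono)
  qed
  have "ennreal (?d (a + 1)) = (\<integral>\<^sup>+x. ennreal (?d (a + 1)) * indicator {a..a + 1} x \<partial>lborel)"
    by (subst nn_integral_cmult_indicator) auto
  also have "\<dots> \<le> (\<integral>\<^sup>+x. ennreal (?d x) * indicator {a..a + 1} x \<partial>lborel)"
    by (intro nn_integral_mono) (auto simp: indicator_def intro!: ennreal_leI mono)
  also have "\<dots> = emeasure M (X -` {a..a + 1} \<inter> space M)"
    by (rule distributed_emeasure[OF X, symmetric]) auto
  also have "\<dots> \<le> emeasure M {\<omega> \<in> space M. a \<le> X \<omega>}"
    by (intro emeasure_mono) auto
  finally show ?thesis by (simp add: emeasure_eq_measure)
qed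

lemma normal_not_AE_bounded:
  assumes X: "distributed M lborel X (\<lambda>x. ennreal (normal_density 0 s x))" and s: "s > 0"
  shows "\<not> (AE \<omega> in M. \<bar>X \<omega>\<bar> \<le> C)"
proof
  assume ae: "AE \<omega> in M. \<bar>X \<omega>\<bar> \<le> C"
  define a where "a = \<bar>C\<bar> + 1"
  have [measurable]: "X \<in> borel_measurable M" using X by (simp add: distributed_def)
  have "prob {\<omega> \<in> space M. a \<le> X \<omega>} = 0"
    using ae by (subst prob_eq_0) (auto simp: a_def elim!: eventually_mono)
  moreover have "normal_density 0 s (a + 1) > 0" using s by (rule normal_density_pos)
  ultimately show False using normal_density_le_tail[OF X, of a] by (simp add: a_def)
qed

end

section \<open>The scheme along the Brownian filtration\<close>

lemma space_augmented_filtration [simp]: "space (augmented_filtration M W t) = space M"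
  unfolding augmented_filtration_def by (rule space_measure_of_conv)

lemma sets_augmented_filtration:
  "sets (augmented_filtration M W t) = sigma_sets (space M)
     ({W s -` A \<inter> space M | s A. 0 \<le> s \<and> s \<le> t \<and> A \<in> sets borel} \<union> null_sets M)"
  unfolding augmented_filtration_def
  by (rule sets_measure_of) (auto dest: null_setsD2 sets.sets_into_space)

lemma subalgebra_augmented_filtration:
  assumes "\<And>s. 0 \<le> s \<Longrightarrow> s \<le> t \<Longrightarrow> W s \<in> borel_measurable M"
  shows "subalgebra M (augmented_filtration M W t)"
  unfolding subalgebra_def sets_augmented_filtration
  using assms by (auto intro!: sets.sigma_sets_subset measurable_sets)

lemma measurable_augmented_filtration:
  assumes "0 \<le> s" "s \<le> t"
  shows "W s \<in> borel_measurable (augmented_filtration M W t)"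
  using assms
  by (intro measurableI) (auto simp: sets_augmented_filtration intro!: sigma_sets.Basic)

text \<open>Backwards in time, each conditional expectation is taken of a variable that is already known at
  the corresponding grid time, so it changes nothing up to null sets.\<close>

lemma explicit_euler_adapted_terminal:
  assumes sub: "\<And>i. m \<le> i \<Longrightarrow> i < N \<Longrightarrow> sigma_finite_subalgebra M (F (real i / real N))"
    and meas: "\<And>i. m \<le> i \<Longrightarrow> i < N \<Longrightarrow> \<xi> \<in> borel_measurable (F (real i / real N))"
    and xi: "\<xi> \<in> borel_measurable M"
    and int: "\<And>P. integrable M (\<lambda>\<omega>. poly P (\<xi> \<omega>))"
    and k: "m + k \<le> N"
  shows "explicit_euler M F \<xi> N (N - k) \<in> borel_measurable M \<and>
    (AE \<omega> in M. explicit_euler M F \<xi> N (N - k) \<omega> = (euler_step N ^^ k) (\<xi> \<omega>))"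
  using k
proof (induction k)
  case 0
  then show ?case using xi by (simp add: explicit_euler.simps)
next
  case (Suc k)
  define i where "i = N - Suc k"
  have i: "m \<le> i" "i < N" "Suc i = N - k" using Suc.prems by (auto simp: i_def)
  interpret sigma_finite_subalgebra M "F (real i / real N)" using sub i by blast
  let ?f = "\<lambda>\<omega>. explicit_euler M F \<xi> N (Suc i) \<omega> - 1 / real N * (explicit_euler M F \<xi> N (Suc i) \<omega>) ^ 3"
  let ?g = "\<lambda>\<omega>. (euler_step N ^^ Suc k) (\<xi> \<omega>)"
  have step: "explicit_euler M F \<xi> N i = real_cond_exp M (F (real i / real N)) ?f"
    using i by (subst explicit_euler.simps) simp
  have IH: "explicit_euler M F \<xi> N (Suc i) \<in> borel_measurable M"
    "AE \<omega> in M. explicit_euler M F \<xi> N (Suc i) \<omega> = (euler_step N ^^ k) (\<xi> \<omega>)"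
    using Suc i by auto
  obtain P where P: "\<And>y. (euler_step N ^^ Suc k) y = poly P y"
    using euler_step_iterate_poly by blast
  have gF: "?g \<in> borel_measurable (F (real i / real N))"
    unfolding P poly_altdef using meas[OF i(1,2)] by measurable
  have gM: "?g \<in> borel_measurable M"
    unfolding P poly_altdef using xi by measurable
  have fg: "AE \<omega> in M. ?f \<omega> = ?g \<omega>"
    using IH(2) by eventually_elim (simp add: euler_step_def)
  have "AE \<omega> in M. real_cond_exp M (F (real i / real N)) ?f \<omega>
      = real_cond_exp M (F (real i / real N)) ?g \<omega>"
    using fg IH(1) gM by (intro real_cond_exp_cong) auto
  moreover have "AE \<omega> in M. real_cond_exp M (F (real i / real N)) ?g \<omega> = ?g \<omega>"
    using int[of P] gF by (intro real_cond_exp_F_meas) (simp_all only: P)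
  ultimately have "AE \<omega> in M. explicit_euler M F \<xi> N i \<omega> = ?g \<omega>"
    unfolding step by eventually_elim simp
  moreover have "explicit_euler M F \<xi> N i \<in> borel_measurable M"
    unfolding step by (rule borel_measurable_cond_exp2)
  ultimately show ?case by (simp add: i_def)
qed

section \<open>Explosion at time one half\<close>

text \<open>Restricting the expectation to the event that \<open>X\<close> exceeds \<open>2 * sqrt N\<close> already suffices: the
  density factor decays only like \<open>exp (- c * N)\<close>.\<close>

lemma (in prob_space) expectation_euler_iterate_ge:
  assumes X: "distributed M lborel X (\<lambda>x. ennreal (normal_density 0 s x))" and s: "s > 0"
    and N: "N > 0"
  shows "sqrt N * 2 ^ 2 ^ k * normal_density 0 s (2 * sqrt N + 1)
    \<le> expectation (\<lambda>\<omega>. \<bar>(euler_step N ^^ k) (X \<omega>)\<bar>)"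
proof -
  let ?A = "{\<omega> \<in> space M. 2 * sqrt N \<le> X \<omega>}" and ?c = "sqrt N * 2 ^ 2 ^ k"
  have [measurable]: "X \<in> borel_measurable M" using X by (simp add: distributed_def)
  obtain P where P: "\<And>y. (euler_step N ^^ k) y = poly P y"
    using euler_step_iterate_poly by blast
  have "?c * normal_density 0 s (2 * sqrt N + 1) \<le> ?c * prob ?A"
    by (intro mult_left_mono normal_density_le_tail[OF X]) auto
  also have "\<dots> = expectation (\<lambda>\<omega>. ?c * indicator ?A \<omega>)"
    by simp
  also have "\<dots> \<le> expectation (\<lambda>\<omega>. \<bar>(euler_step N ^^ k) (X \<omega>)\<bar>)"
  proof (intro integral_mono)
    show "integrable M (\<lambda>\<omega>. \<bar>(euler_step N ^^ k) (X \<omega>)\<bar>)"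
      unfolding P by (intro integrable_abs integrable_normal_poly[OF X s])
    show "?c * indicator ?A \<omega> \<le> \<bar>(euler_step N ^^ k) (X \<omega>)\<bar>" for \<omega>
      using euler_step_iterate_growth[OF N, of "X \<omega>" k] by (auto simp: indicator_def)
  qed (auto intro!: integrable_mult_right simp: integrable_indicator_iff less_top[symmetric])
  finally show ?thesis .
qed

theorem lemma1p1:
  fixes M :: "'a measure" and W :: "real \<Rightarrow> 'a \<Rightarrow> real"
  assumes "prob_space M"
    and "complete_measure M"
    and "brownian_motion_01 M W"
  shows "\<exists>\<xi> :: 'a \<Rightarrow> real.
    (\<forall>p::real. 2 \<le> p \<longrightarrow>
       \<xi> \<in> Lp_rv M (augmented_filtration M W 1) p - Linfty_rv M (augmented_filtration M W 1)) \<and>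
    filterlim
      (\<lambda>N. \<integral>\<omega>. \<bar>explicit_euler M (augmented_filtration M W) \<xi> N (N div 2) \<omega>\<bar> \<partial>M)
      at_top (inf sequentially (principal {N. even N}))"
proof -
  interpret prob_space M by fact
  let ?F = "augmented_filtration M W"
  define s :: real where "s = sqrt (1 / 2)"
  \<comment> \<open>The increment rather than \<open>W (1 / 2)\<close> itself: its law is given directly, whereas \<open>W 0 = 0\<close> holds
     only almost surely.\<close>
  define \<xi> where "\<xi> = (\<lambda>\<omega>. W (1 / 2) \<omega> - W 0 \<omega>)"
  have s: "s > 0" by (simp add: s_def)
  have Wm: "W t \<in> borel_measurable M" if "0 \<le> t" "t \<le> 1" for t
    using assms(3) that by (auto simp: brownian_motion_01_def)
  have "distributed M lborel (\<lambda>\<omega>. W (1 / 2) \<omega> - W 0 \<omega>)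
      (\<lambda>x. ennreal (normal_density 0 (sqrt (1 / 2 - 0)) x))"
    using assms(3) unfolding brownian_motion_01_def by auto
  then have X: "distributed M lborel \<xi> (\<lambda>x. ennreal (normal_density 0 s x))"
    by (simp add: \<xi>_def s_def)
  have \<xi>M: "\<xi> \<in> borel_measurable M" using X by (simp add: distributed_def)
  have \<xi>F: "\<xi> \<in> borel_measurable (?F t)" if "1 / 2 \<le> t" for t
    unfolding \<xi>_def using that
    by (intro borel_measurable_diff measurable_augmented_filtration) auto
  have sub: "sigma_finite_subalgebra M (?F t)" if "t \<le> 1" for t
  proof -
    have "finite_measure_subalgebra M (?F t)"
      using Wm that by unfold_locales (auto intro!: subalgebra_augmented_filtration)
    then interpret finite_measure_subalgebra M "?F t" .
    show ?thesis ..
  qed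

  have terminal: "\<xi> \<in> Lp_rv M (?F 1) p - Linfty_rv M (?F 1)" if "2 \<le> p" for p
    using \<xi>F[of 1] integrable_normal_abs_powr[OF X s, of p] normal_not_AE_bounded[OF X s] that
    by (auto simp: Lp_rv_def Linfty_rv_def)

  let ?E = "\<lambda>N. \<integral>\<omega>. \<bar>explicit_euler M ?F \<xi> N (N div 2) \<omega>\<bar> \<partial>M"
  let ?L = "\<lambda>N::nat. sqrt N * 2 powr (2 powr (N / 2)) * normal_density 0 s (2 * sqrt N + 1)"
  have lower: "?L N \<le> ?E N" if "N > 0" "even N" for N
  proof -
    have half: "N - N div 2 = N div 2" "real (N div 2) = N / 2" using \<open>even N\<close> by auto
    have late: "1 / 2 \<le> real i / real N" if "N div 2 \<le> i" for i
      using that \<open>N > 0\<close> half by (simp add: field_simps)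
    have ae: "explicit_euler M ?F \<xi> N (N - N div 2) \<in> borel_measurable M \<and>
      (AE \<omega> in M. explicit_euler M ?F \<xi> N (N - N div 2) \<omega> = (euler_step N ^^ (N div 2)) (\<xi> \<omega>))"
      by (rule explicit_euler_adapted_terminal[where m = "N div 2"])
        (auto intro!: sub \<xi>F late \<xi>M integrable_normal_poly[OF X s])
    obtain P where P: "\<And>y. (euler_step N ^^ (N div 2)) y = poly P y"
      using euler_step_iterate_poly by blast
    have "?E N = (\<integral>\<omega>. \<bar>(euler_step N ^^ (N div 2)) (\<xi> \<omega>)\<bar> \<partial>M)"
    proof (rule integral_cong_AE)
      show "(\<lambda>\<omega>. \<bar>(euler_step N ^^ (N div 2)) (\<xi> \<omega>)\<bar>) \<in> borel_measurable M"
        unfolding P poly_altdef using \<xi>M by measurable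
      show "AE \<omega> in M. \<bar>explicit_euler M ?F \<xi> N (N div 2) \<omega>\<bar> = \<bar>(euler_step N ^^ (N div 2)) (\<xi> \<omega>)\<bar>"
        using ae unfolding half by (auto elim!: eventually_mono)
    qed (use ae half in auto)
    moreover have "2 powr (2 powr (N / 2)) = (2::real) ^ 2 ^ (N div 2)"
    proof -
      have "2 powr (N / 2) = real (2 ^ (N div 2))"
        unfolding half(2)[symmetric] by (subst powr_realpow) auto
      then show ?thesis by (simp only: powr_realpow zero_less_numeral)
    qed
    ultimately show ?thesis
      using expectation_euler_iterate_ge[OF X s \<open>N > 0\<close>, of "N div 2"] by simp
  qed
  have "filterlim ?L at_top sequentially"
    unfolding s_def normal_density_def by (simp, real_asymp)
  then have "filterlim ?L at_top (inf sequentially (principal {N. even N}))"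
    by (rule filterlim_mono) auto
  then have "filterlim ?E at_top (inf sequentially (principal {N. even N}))"
  proof (rule filterlim_at_top_mono)
    show "eventually (\<lambda>N. ?L N \<le> ?E N) (inf sequentially (principal {N. even N}))"
      unfolding eventually_inf_principal
      using eventually_gt_at_top[of 0] by eventually_elim (auto intro: lower)
  qed
  with terminal show ?thesis by blast
qed

end
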